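(* Let $A\in\mathbb{R}^{n\times n}$ be nonsingular, $u,v,b\in\mathbb{R}^n$, and suppose that the linear systems $Ay=b$ and $Az=u$ are solved normwise backward stably with stability constant $c_s$. Let $\widehat x$ be the solution of $(A+uv^T)x=b$ computed by the Sherman--Morrison algorithm (SM) in floating point arithmetic with unit roundoff $\epsilon_M$, and let $\widehat y$ be the computed solution of $Ay=b$ in that algorithm. The computed vector $\widehat y$ obeys the known bound $$\|\widehat y\|\le\frac{\|A^{-1}\|\,\|b\|}{1-c_1\epsilon_M\kappa(A)},$$ where $c_1$ denotes the constant of that bound. Using it, the residual $r=b-(A+uv^T)\widehat x$ satisfies $$\|r\|\le\epsilon_M(n+2+c_s)\big(\|A\|+\|u\|\|v\|\big)\|\widehat x\|+\epsilon_M c_s\|b\|+\epsilon_M\frac{2n+3+2c_s}{1-c_1\epsilon_M\kappa(A)}\big(\|A\|+\|u\|\|v\|\big)\|A^{-1}\|\,\|b\|+\mathcal O(\epsilon_M^2),$$ and, similarly, the relative backward error $\omega(\widehat x)=\dfrac{\|r\|}{\|A+uv^T\|\,\|\widehat x\|+\|b\|}$ satisfies $$\omega(\widehat x)\le\epsilon_M(n+2+c_s)\frac{\big(\|A\|+\|u\|\|v\|\big)\|\widehat x\|+\|b\|}{\|A+uv^T\|\,\|\widehat x\|+\|b\|}+\epsilon_M\frac{2n+3+2c_s}{1-c_1\epsilon_M\kappa(A)}\,\frac{\big(\|A\|+\|u\|\|v\|\big)\|A^{-1}\|\,\|b\|}{\|A+uv^T\|\,\|\widehat x\|+\|b\|}+\mathcal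 O(\epsilon_M^2).$$ While the first term on the right-hand side of the last bound can typically be expected to be $\mathcal O(\epsilon_M)$, the second term is $\mathcal O(\epsilon_M\kappa(A))$, as Higham conjectured. The bound also suggests that the backward error could be large when $\|A+uv^T\|\ll\|A\|+\|u\|\|v\|$.
   Context: Norms: $\|\cdot\|$ is the Euclidean vector norm and the induced matrix 2-norm; $\kappa(A)=\|A\|\,\|A^{-1}\|$. Algorithm SM (for $(A+uv^T)x=b$): (1) solve $Ay=b$ for $y$; (2) solve $Az=u$ for $z$; (3) compute $\alpha=v^Ty$, $\beta=1+v^Tz$, $\theta=\alpha/\beta$; (4) output $x=y-z\theta$. Hats denote the quantities actually computed in floating point arithmetic. The matrix $A+uv^T$ is nonsingular (equivalently, the exact $\beta$ is nonzero), and the algorithm runs to completion, so the computed $\widehat\beta$ is nonzero. Floating point model: $\epsilon_M$ is the unit roundoff, $n\epsilon_M<1$, $\gamma_n=n\epsilon_M/(1-n\epsilon_M)$. Every scalar operation satisfies $\mathrm{fl}(a\circ b)=(a\circ b)(1+\delta)$, $|\delta|\le\epsilon_M$, $\circ\in\{+,-,\times,/\}$ (vector operations being performed entrywise). A computed inner product satisfies $\mathrm{fl}(v^Tw)=v^T(I+D)w$ with $D$ diagonal and $|D|\le\gamma_n I$ entrywise. Normwise backward stable solve with (modest) constant $c_s$: for a right-hand side $g$, the computed solution $\widehat s$ of $As=g$ satisfies $(A+\delta A)\widehat s=g+\delta g$ for some $\delta A,\delta g$ (which may differ from solve to solve) with $\|\delta A\|\le c_s\epsilon_M\|A\|$ and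 $\|\delta g\|\le c_s\epsilon_M\|g\|$. The constant $c_1$ is the one in the bound on $\|\widehat y\|$ displayed in the claim, which is an established fact for the backward stable solve of $Ay=b$ (proved by Hashemi and Nakatsukasa in earlier work on the Sherman--Morrison formula); it is understood that $c_1\epsilon_M\kappa(A)<1$. $\mathcal O(\epsilon_M^2)$ denotes second-order terms in $\epsilon_M$. Higham's conjecture refers to his open question whether the backward error of SM admits a bound proportional to the condition number of $A$. *)

theory Defs
  imports "HOL-Analysis.Analysis" "HOL-Library.Landau_Symbols"
begin

definition norm2 :: "real^'n^'m \<Rightarrow> real" where
  "norm2 A = onorm ((*v) A)"

definition kappa :: "real^'n^'n \<Rightarrow> real" where
  "kappa A = norm2 A * norm2 (matrix_inv A)"

definition outer :: "real^'n \<Rightarrow> real^'n \<Rightarrow> real^'n^'n" where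
  "outer u v = (\<chi> i j. u $ i * v $ j)"

definition residual :: "real^'n^'n \<Rightarrow> real^'n \<Rightarrow> real^'n \<Rightarrow> real^'n \<Rightarrow> real^'n \<Rightarrow> real^'n" where
  "residual A u v b x = b - (A + outer u v) *v x"

definition backward_error :: "real^'n^'n \<Rightarrow> real^'n \<Rightarrow> real^'n \<Rightarrow> real^'n \<Rightarrow> real^'n \<Rightarrow> real" where
  "backward_error A u v b x =
     norm (residual A u v b x) / (norm2 (A + outer u v) * norm x + norm b)"

text \<open>Rounding is modelled relationally: \<open>fl \<epsilon> a s\<close> says that \<open>s\<close> is an admissible
  computed value of a single scalar operation whose exact result is \<open>a\<close>.\<close>

definition fl :: "real \<Rightarrow> real \<Rightarrow> real \<Rightarrow> bool" where
  "fl \<epsilon> a s \<longleftrightarrow> (\<exists>\<delta>. \<bar>\<delta>\<bar> \<le> \<epsilon> \<and> s = a * (1 + \<delta>))"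

definition gam :: "nat \<Rightarrow> real \<Rightarrow> real" where
  "gam n \<epsilon> = real n * \<epsilon> / (1 - real n * \<epsilon>)"

text \<open>Since \<open>mat 1\<close> vanishes off the diagonal, the entrywise bound forces \<open>D\<close> to be diagonal.\<close>

definition fl_inner :: "real \<Rightarrow> real^'n \<Rightarrow> real^'n \<Rightarrow> real \<Rightarrow> bool" where
  "fl_inner \<epsilon> v w s \<longleftrightarrow>
     (\<exists>D::real^'n^'n. (\<forall>i j. \<bar>D $ i $ j\<bar> \<le> (gam CARD('n) \<epsilon> *\<^sub>R mat 1) $ i $ j) \<and>
        s = v \<bullet> ((mat 1 + D) *v w))"

definition backward_stable_solve ::
    "real \<Rightarrow> real \<Rightarrow> real^'n^'n \<Rightarrow> real^'n \<Rightarrow> real^'n \<Rightarrow> bool" where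
  "backward_stable_solve cs \<epsilon> A g s \<longleftrightarrow>
     (\<exists>\<delta>A \<delta>g. (A + \<delta>A) *v s = g + \<delta>g \<and>
        norm2 \<delta>A \<le> cs * \<epsilon> * norm2 A \<and> norm \<delta>g \<le> cs * \<epsilon> * norm g)"

text \<open>\<open>y\<close>, \<open>z\<close>, \<open>\<alpha>\<close>, \<open>\<beta>\<close>, \<open>\<theta>\<close>, \<open>x\<close> are the computed (hatted) quantities of one run of the
  Sherman--Morrison algorithm with unit roundoff \<open>\<epsilon>\<close>; \<open>t\<close> and \<open>w\<close> are the computed
  intermediate results for the inner product \<open>v \<bullet> z\<close> and the scaled vector \<open>\<theta> z\<close>.\<close>

definition SM_run ::
    "real \<Rightarrow> real \<Rightarrow> real^'n^'n \<Rightarrow> real^'n \<Rightarrow> real^'n \<Rightarrow> real^'n \<Rightarrow>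
     real^'n \<Rightarrow> real^'n \<Rightarrow> real \<Rightarrow> real \<Rightarrow> real \<Rightarrow> real^'n \<Rightarrow> bool" where
  "SM_run cs \<epsilon> A u v b y z \<alpha> \<beta> \<theta> x \<longleftrightarrow>
     0 < \<epsilon> \<and> real CARD('n) * \<epsilon> < 1 \<and>
     backward_stable_solve cs \<epsilon> A b y \<and>
     backward_stable_solve cs \<epsilon> A u z \<and>
     fl_inner \<epsilon> v y \<alpha> \<and>
     (\<exists>t. fl_inner \<epsilon> v z t \<and> fl \<epsilon> (1 + t) \<beta>) \<and>
     \<beta> \<noteq> 0 \<and> fl \<epsilon> (\<alpha> / \<beta>) \<theta> \<and>
     (\<exists>w::real^'n. (\<forall>i. fl \<epsilon> (z $ i * \<theta>) (w $ i)) \<and> (\<forall>i. fl \<epsilon> (y $ i - w $ i) (x $ i)))"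

text \<open>The bound on the computed solution of \<open>Ay = b\<close> that the theorem takes as known, with constant
  \<open>c\<^sub>1\<close>; the lemma shows that \<open>c\<^sub>1 = 2 c\<^sub>s\<close> is always admissible.\<close>

lemma solve_bound:
  fixes A :: "real^'n^'n"
  assumes inv: "invertible A" and e: "0 < e" and s: "backward_stable_solve cs e A g s"
    and small: "2 * cs * e * kappa A < 1"
  shows "norm s \<le> norm2 (matrix_inv A) * norm g / (1 - 2 * cs * e * kappa A)"
proof -
  have op: "norm (B *v w) \<le> norm2 B * norm w" for B :: "real^'n^'n" and w
    unfolding norm2_def by (rule onorm) simp
  have pos: "0 \<le> norm2 B" for B :: "real^'n^'n"
    unfolding norm2_def by (rule onorm_pos_le) simp
  have AI: "matrix_inv A *v (A *v w) = w" "A *v (matrix_inv A *v w) = w" for w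
    using someI_ex[OF inv[unfolded invertible_def]]
    by (simp_all add: matrix_vector_mul_assoc matrix_inv_def)
  obtain dA dg where *: "(A + dA) *v s = g + dg" "norm2 dA \<le> cs * e * norm2 A"
      "norm dg \<le> cs * e * norm g"
    using s unfolding backward_stable_solve_def by blast
  define w :: "real^'n" where "w = (\<chi> i. 1)"
  have w: "w \<noteq> 0" by (simp add: w_def vec_eq_iff)
  have "norm w = norm (matrix_inv A *v (A *v w))" using AI by simp
  also have "\<dots> \<le> norm2 (matrix_inv A) * (norm2 A * norm w)"
    by (rule order_trans[OF op mult_left_mono[OF op pos]])
  finally have k1: "1 \<le> kappa A" using w by (simp add: kappa_def mult_ac)
  have "norm2 A \<noteq> 0" using k1 by (auto simp: kappa_def)
  hence Apos: "norm2 A > 0" using pos[of A] by simp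
  have "0 \<le> cs * e * norm2 A" using *(2) pos[of dA] by linarith
  hence c0: "0 \<le> cs * e" using Apos by (simp add: zero_le_mult_iff)
  define c where "c = cs * e"
  have "s = matrix_inv A *v (g + dg - dA *v s)"
    unfolding *(1)[symmetric] by (simp add: matrix_vector_mult_add_rdistrib AI)
  hence "norm s \<le> norm2 (matrix_inv A) * norm (g + dg - dA *v s)"
    using op[of "matrix_inv A" "g + dg - dA *v s"] by simp
  also have "\<dots> \<le> norm2 (matrix_inv A) * (norm g + c * norm g + c * norm2 A * norm s)"
  proof (rule mult_left_mono)
    have "norm (dA *v s) \<le> c * norm2 A * norm s"
      unfolding c_def by (rule order_trans[OF op mult_right_mono[OF *(2) norm_ge_zero]])
    thus "norm (g + dg - dA *v s) \<le> norm g + c * norm g + c * norm2 A * norm s"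
      using *(3) norm_triangle_ineq4[of "g + dg" "dA *v s"] norm_triangle_ineq[of g dg]
      unfolding c_def by linarith
  qed (rule pos)
  finally have main: "norm s * (1 - c * kappa A) \<le> (norm2 (matrix_inv A) * norm g) * (1 + c)"
    by (simp add: kappa_def algebra_simps)
  have d: "0 < 1 - 2 * c * kappa A" using small by (simp add: c_def mult_ac)
  have ck: "0 \<le> c * kappa A" using c0 k1 by (simp add: c_def)
  have cle: "c \<le> c * kappa A" using c0 k1 mult_left_mono[of 1 "kappa A" c] by (simp add: c_def)
  have "(1 + c) * (1 - 2 * c * kappa A) \<le> 1 - c * kappa A"
    using cle ck c0 mult_nonneg_nonneg[of c "c * kappa A"] by (simp add: c_def algebra_simps)
  hence "norm2 (matrix_inv A) * norm g * ((1 + c) * (1 - 2 * c * kappa A))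
      \<le> norm2 (matrix_inv A) * norm g * (1 - c * kappa A)"
    by (rule mult_left_mono) (simp add: pos)
  moreover have "norm s * (1 - c * kappa A) * (1 - 2 * c * kappa A)
      \<le> norm2 (matrix_inv A) * norm g * (1 + c) * (1 - 2 * c * kappa A)"
    by (rule mult_right_mono[OF main]) (use d in simp)
  ultimately have "norm s * (1 - 2 * c * kappa A) * (1 - c * kappa A)
      \<le> norm2 (matrix_inv A) * norm g * (1 - c * kappa A)"
    by (simp only: mult_ac)
  moreover have "0 < 1 - c * kappa A" using d ck by linarith
  ultimately have "norm s * (1 - 2 * c * kappa A) \<le> norm2 (matrix_inv A) * norm g"
    by (rule mult_right_le_imp_le)
  thus ?thesis using d by (simp add: c_def pos_le_divide_eq mult_ac)
qed

end

theory Submission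
  imports Defs
begin

text \<open>Substituting the perturbed equations for \<open>y\<close> and \<open>z\<close> into the residual leaves the solver
  perturbations, the rounding errors of \<open>y - \<theta> z\<close>, and the defect of \<open>\<theta> (1 + v \<bullet> z) = v \<bullet> y\<close>
  times \<open>u\<close>. To first order \<open>\<theta> = v \<bullet> x\<close> and \<open>\<parallel>\<theta> z\<parallel> \<le> \<parallel>x\<parallel> + \<parallel>y\<parallel>\<close>, so everything is expressed by
  \<open>\<parallel>x\<parallel>\<close>, \<open>\<parallel>y\<parallel>\<close> and \<open>\<parallel>b\<parallel>\<close>. The second-order terms are uniform in the run because the exact \<open>\<beta>\<close> is
  nonzero, which keeps the computed \<open>y\<close>, \<open>z\<close> and \<open>\<theta>\<close> bounded for small \<open>\<epsilon>\<close>.\<close>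

section \<open>Spectral norm, inverse and rank-one update\<close>

lemma norm_matrix_vector_le: "norm (B *v w) \<le> norm2 B * norm w"
  unfolding norm2_def by (rule onorm) simp

lemma norm2_nonneg [simp]: "0 \<le> norm2 B"
  unfolding norm2_def by (rule onorm_pos_le) simp

lemma norm2_eq_0_imp: "norm2 B = 0 \<Longrightarrow> B *v w = 0"
  using norm_matrix_vector_le[of B w] by simp

lemma matrix_inv_vector:
  assumes "invertible (A :: real^'n^'n)"
  shows "matrix_inv A *v (A *v w) = w" "A *v (matrix_inv A *v w) = w"
  using someI_ex[OF assms[unfolded invertible_def]]
  by (simp_all add: matrix_vector_mul_assoc matrix_inv_def)

lemma norm2_pos:
  assumes "invertible (A :: real^'n^'n)"
  shows "0 < norm2 A"
proof (rule ccontr)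
  assume "\<not> 0 < norm2 A"
  hence "norm2 A = 0" using norm2_nonneg[of A] by linarith
  hence "A *v (1 :: real^'n) = 0" by (rule norm2_eq_0_imp)
  hence "(1 :: real^'n) = 0" using matrix_inv_vector(1)[OF assms, of 1] by simp
  thus False by simp
qed

lemma outer_vector: "outer u v *v x = (v \<bullet> x) *\<^sub>R u"
  by (simp add: vec_eq_iff outer_def matrix_vector_mult_def inner_vec_def sum_distrib_left
      sum_distrib_right mult_ac)

text \<open>Splitting off the rank-one part produces the factor
  \<open>norm2 A + norm u * norm v\<close> of the claim, which can be much larger than
  \<open>norm2 (A + outer u v)\<close>.\<close>

lemma norm_update_le:
  "norm ((A + outer u v) *v w) \<le> (norm2 A + norm u * norm v) * norm w"
proof -
  have "norm ((A + outer u v) *v w) \<le> norm (A *v w) + norm ((v \<bullet> w) *\<^sub>R u)"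
    unfolding matrix_vector_mult_add_rdistrib outer_vector by (rule norm_triangle_ineq)
  moreover have "norm ((v \<bullet> w) *\<^sub>R u) \<le> norm v * norm w * norm u"
    using Cauchy_Schwarz_ineq2[of v w] by (simp add: mult_right_mono)
  ultimately show ?thesis
    using norm_matrix_vector_le[of A w] by (simp add: algebra_simps)
qed

section \<open>Consequences of the rounding model\<close>

lemma norm_componentwise_scale_le:
  fixes e w :: "real^'n"
  assumes "0 \<le> c" "\<And>i. \<bar>e $ i\<bar> \<le> c * \<bar>w $ i\<bar>"
  shows "norm e \<le> c * norm w"
proof -
  have "norm e \<le> norm (c *\<^sub>R w)"
    using assms by (intro norm_le_componentwise_cart) (simp add: abs_mult)
  thus ?thesis using assms(1) by simp
qed

lemma fl_error:
  assumes "fl \<epsilon> a s"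
  shows "\<bar>s - a\<bar> \<le> \<epsilon> * \<bar>a\<bar>"
proof -
  obtain \<delta> where "\<bar>\<delta>\<bar> \<le> \<epsilon>" "s = a * (1 + \<delta>)" using assms unfolding fl_def by blast
  hence "\<bar>s - a\<bar> = \<bar>\<delta>\<bar> * \<bar>a\<bar>" by (simp add: algebra_simps abs_mult)
  thus ?thesis using \<open>\<bar>\<delta>\<bar> \<le> \<epsilon>\<close> by (simp add: mult_right_mono)
qed

lemma fl_inner_error:
  fixes v w :: "real^'n"
  assumes "fl_inner \<epsilon> v w s" "0 \<le> gam CARD('n) \<epsilon>"
  shows "\<bar>s - v \<bullet> w\<bar> \<le> gam CARD('n) \<epsilon> * (norm v * norm w)"
proof -
  let ?g = "gam CARD('n) \<epsilon>"
  obtain D :: "real^'n^'n" where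
    D: "\<And>i j. \<bar>D $ i $ j\<bar> \<le> (?g *\<^sub>R mat 1) $ i $ j" and s: "s = v \<bullet> ((mat 1 + D) *v w)"
    using assms(1) unfolding fl_inner_def by blast
  \<comment> \<open>Being diagonal, \<open>D\<close> only rescales the entries of \<open>w\<close>,
    so passing from entries to norms costs no factor depending on the dimension.\<close>
  have off: "D $ i $ j = 0" if "i \<noteq> j" for i j using D[of i j] that by (simp add: mat_def)
  have "(D *v w) $ i = D $ i $ i * w $ i" for i
  proof -
    have "(D *v w) $ i = (\<Sum>j\<in>UNIV. if j = i then D $ i $ i * w $ i else 0)"
      unfolding matrix_vector_mult_def vec_lambda_beta
      by (rule sum.cong) (auto simp: off)
    thus ?thesis by simp
  qed
  moreover have "\<bar>D $ i $ i\<bar> \<le> ?g" for i using D[of i i] by (simp add: mat_def)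
  ultimately have "norm (D *v w) \<le> ?g * norm w"
    by (intro norm_componentwise_scale_le[OF assms(2)]) (simp add: abs_mult mult_right_mono)
  hence "norm v * norm (D *v w) \<le> norm v * (?g * norm w)" by (rule mult_left_mono) simp
  moreover have "s - v \<bullet> w = v \<bullet> (D *v w)"
    by (simp add: s matrix_vector_mult_add_rdistrib inner_add_right)
  ultimately show ?thesis using Cauchy_Schwarz_ineq2[of v "D *v w"] by (simp add: mult_ac)
qed

text \<open>The linear bound serves where constants may be crude. The last one isolates
  \<open>n * \<epsilon>\<close> from a quadratic remainder, which keeps the first-order coefficient
  sharp.\<close>

lemma gam_bounds:
  assumes "0 \<le> \<epsilon>" "real n * \<epsilon> \<le> 1/2"
  shows "0 \<le> gam n \<epsilon>" "gam n \<epsilon> \<le> 2 * real n * \<epsilon>"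
    "gam n \<epsilon> \<le> real n * \<epsilon> + 2 * (real n)\<^sup>2 * \<epsilon>\<^sup>2"
proof -
  define q where "q = real n * \<epsilon>"
  have q: "0 \<le> q" "q \<le> 1/2" using assms by (simp_all add: q_def)
  have g: "gam n \<epsilon> = q / (1 - q)" by (simp add: gam_def q_def)
  show "0 \<le> gam n \<epsilon>" using q by (simp add: g)
  have "q * (2 * q) \<le> q * 1" using q by (intro mult_left_mono) auto
  hence "q / (1 - q) \<le> 2 * q" using q by (simp add: pos_divide_le_eq algebra_simps)
  thus "gam n \<epsilon> \<le> 2 * real n * \<epsilon>" by (simp add: g q_def)
  have "q\<^sup>2 * (2 * q) \<le> q\<^sup>2 * 1" using q by (intro mult_left_mono) auto
  hence "q / (1 - q) \<le> q + 2 * q\<^sup>2" using q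
    by (simp add: pos_divide_le_eq algebra_simps power2_eq_square)
  thus "gam n \<epsilon> \<le> real n * \<epsilon> + 2 * (real n)\<^sup>2 * \<epsilon>\<^sup>2" by (simp add: g q_def power_mult_distrib)
qed

lemma card_mult_half_imp:
  assumes "0 < \<epsilon>" "real CARD('n::finite) * \<epsilon> \<le> 1/2"
  shows "\<epsilon> \<le> 1/2"
proof -
  have "1 \<le> real CARD('n)" by simp
  hence "1 * \<epsilon> \<le> real CARD('n) * \<epsilon>" using assms(1) by (intro mult_right_mono) auto
  thus ?thesis using assms(2) by simp
qed

section \<open>The defect of the computed scalar \<theta>\<close>

lemma SM_run_cs_nonneg:
  assumes "invertible A" "SM_run cs \<epsilon> A u v b y z \<alpha> \<beta> \<theta> x"
  shows "0 \<le> cs"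
proof -
  \<comment> \<open>The run itself supplies a perturbation whose nonnegative norm is at most
    \<open>cs\<close> times a positive number.\<close>
  obtain E :: "real^'a^'a" where "norm2 E \<le> cs * \<epsilon> * norm2 A" "0 < \<epsilon>"
    using assms(2) unfolding SM_run_def backward_stable_solve_def by blast
  hence "0 \<le> cs * (\<epsilon> * norm2 A)" "0 < \<epsilon> * norm2 A"
    using order_trans[OF norm2_nonneg[of E]] norm2_pos[OF assms(1)]
    by (simp_all only: mult.assoc mult_pos_pos)
  thus ?thesis by (simp add: zero_le_mult_iff)
qed

text \<open>Multiplying through by \<open>1 + v \<bullet> z\<close> keeps the bound free of \<open>1 / \<beta>\<close>.\<close>

lemma SM_theta_defect:
  fixes A :: "real^'n^'n"
  assumes run: "SM_run cs \<epsilon> A u v b y z \<alpha> \<beta> \<theta> x"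
    and small: "real CARD('n) * \<epsilon> \<le> 1/2"
  defines "n \<equiv> real CARD('n)"
  shows "\<bar>\<theta> * (1 + v \<bullet> z) - v \<bullet> y\<bar>
    \<le> \<epsilon> * (norm v * ((n + 2) * norm y + n * (\<bar>\<theta>\<bar> * norm z)))
      + \<epsilon>\<^sup>2 * (norm v * ((2 * n\<^sup>2 + 8 * n + 4) * norm y + 2 * n\<^sup>2 * (\<bar>\<theta>\<bar> * norm z)))"
proof -
  let ?g = "gam CARD('n) \<epsilon>"
  have e0: "0 < \<epsilon>" using run by (simp add: SM_run_def)
  note e1 = card_mult_half_imp[OF e0 small]
  note g = gam_bounds[OF less_imp_le[OF e0] small, folded n_def]
  obtain t where ts: "fl_inner \<epsilon> v y \<alpha>" "fl_inner \<epsilon> v z t" "fl \<epsilon> (1 + t) \<beta>"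
      "\<beta> \<noteq> 0" "fl \<epsilon> (\<alpha> / \<beta>) \<theta>"
    using run unfolding SM_run_def by blast
  have Ey: "\<bar>\<alpha> - v \<bullet> y\<bar> \<le> ?g * (norm v * norm y)" by (rule fl_inner_error[OF ts(1) g(1)])
  have Ez: "\<bar>t - v \<bullet> z\<bar> \<le> ?g * (norm v * norm z)" by (rule fl_inner_error[OF ts(2) g(1)])
  obtain d1 where d1: "\<bar>d1\<bar> \<le> \<epsilon>" "\<beta> = (1 + t) * (1 + d1)" using ts(3) unfolding fl_def by blast
  obtain d2 where d2: "\<bar>d2\<bar> \<le> \<epsilon>" "\<theta> = \<alpha> / \<beta> * (1 + d2)" using ts(5) unfolding fl_def by blast
  have pos: "1/2 \<le> 1 + d1" using d1(1) e1 by linarith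
  \<comment> \<open>Substituting the rounded sum for \<beta> leaves only the quotient of two
    rounding factors, equal to 1 up to \<rho>, which is about \<open>2 * \<epsilon>\<close>.\<close>
  have th: "\<theta> * (1 + t) = \<alpha> * ((1 + d2) / (1 + d1))"
    using d1(2) d2(2) ts(4) pos by (simp add: field_simps)
  define \<rho> where "\<rho> = (1 + d2) / (1 + d1) - 1"
  have "\<bar>\<rho>\<bar> = \<bar>d2 - d1\<bar> / (1 + d1)" using pos by (simp add: \<rho>_def field_simps abs_divide)
  also have "\<dots> \<le> 2 * \<epsilon> / (1 - \<epsilon>)"
    using d1(1) d2(1) e0 e1 by (intro frac_le) linarith+
  also have "\<dots> \<le> 2 * \<epsilon> + 4 * \<epsilon>\<^sup>2"
  proof -
    have "\<epsilon>\<^sup>2 * (2 * \<epsilon>) \<le> \<epsilon>\<^sup>2 * 1" using e1 by (intro mult_left_mono) auto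
    thus ?thesis using e1 by (simp add: pos_divide_le_eq algebra_simps power2_eq_square)
  qed
  finally have rho: "\<bar>\<rho>\<bar> \<le> 2 * \<epsilon> + 4 * \<epsilon>\<^sup>2" .
  have "\<epsilon> * (2 * \<epsilon>) \<le> \<epsilon> * 1" using e0 e1 by (intro mult_left_mono) auto
  hence rho': "\<bar>\<rho>\<bar> \<le> 4 * \<epsilon>" using rho by (simp add: power2_eq_square)
  have eq: "\<theta> * (1 + v \<bullet> z) - v \<bullet> y = (\<alpha> - v \<bullet> y) + \<alpha> * \<rho> - \<theta> * (t - v \<bullet> z)"
    using th by (simp add: \<rho>_def algebra_simps)
  have vy: "\<bar>v \<bullet> y\<bar> \<le> norm v * norm y" by (rule Cauchy_Schwarz_ineq2)
  have "\<bar>\<alpha> * \<rho>\<bar> \<le> (norm v * norm y) * \<bar>\<rho>\<bar> + ?g * (norm v * norm y) * \<bar>\<rho>\<bar>"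
  proof -
    have "\<bar>\<alpha>\<bar> \<le> norm v * norm y + ?g * (norm v * norm y)" using Ey vy by linarith
    thus ?thesis unfolding abs_mult
      by (metis abs_ge_zero distrib_right mult_right_mono)
  qed
  \<comment> \<open>The sharp \<open>rho\<close> is used in the first-order part. Where \<rho>
    multiplies \<open>?g\<close>, already of order \<epsilon>, the cruder \<open>rho'\<close>
    suffices; this is the source of \<open>8 * n\<close> in the second-order term.\<close>
  also have "\<dots> \<le> (norm v * norm y) * (2 * \<epsilon> + 4 * \<epsilon>\<^sup>2) + 2 * n * \<epsilon> * (norm v * norm y) * (4 * \<epsilon>)"
    using rho rho' g e0 by (intro add_mono mult_mono) (auto simp: n_def)
  finally have a: "\<bar>\<alpha> * \<rho>\<bar> \<le> \<dots>" .
  have "?g * (norm v * norm y) \<le> (n * \<epsilon> + 2 * n\<^sup>2 * \<epsilon>\<^sup>2) * (norm v * norm y)"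
    using g(3) by (intro mult_right_mono) auto
  hence b: "\<bar>\<alpha> - v \<bullet> y\<bar> \<le> (n * \<epsilon> + 2 * n\<^sup>2 * \<epsilon>\<^sup>2) * (norm v * norm y)" using Ey by linarith
  have "\<bar>t - v \<bullet> z\<bar> \<le> (n * \<epsilon> + 2 * n\<^sup>2 * \<epsilon>\<^sup>2) * (norm v * norm z)"
    using Ez mult_right_mono[OF g(3), of "norm v * norm z"] by simp
  hence c: "\<bar>\<theta> * (t - v \<bullet> z)\<bar> \<le> \<bar>\<theta>\<bar> * ((n * \<epsilon> + 2 * n\<^sup>2 * \<epsilon>\<^sup>2) * (norm v * norm z))"
    by (simp only: abs_mult) (rule mult_left_mono, auto)
  have "\<bar>\<theta> * (1 + v \<bullet> z) - v \<bullet> y\<bar> \<le> \<bar>\<alpha> - v \<bullet> y\<bar> + \<bar>\<alpha> * \<rho>\<bar> + \<bar>\<theta> * (t - v \<bullet> z)\<bar>"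
    unfolding eq by linarith
  also have "\<dots> \<le> (n * \<epsilon> + 2 * n\<^sup>2 * \<epsilon>\<^sup>2) * (norm v * norm y)
      + ((norm v * norm y) * (2 * \<epsilon> + 4 * \<epsilon>\<^sup>2) + 2 * n * \<epsilon> * (norm v * norm y) * (4 * \<epsilon>))
      + \<bar>\<theta>\<bar> * ((n * \<epsilon> + 2 * n\<^sup>2 * \<epsilon>\<^sup>2) * (norm v * norm z))"
    using a b c by (intro add_mono)
  also have "\<dots> = \<epsilon> * (norm v * ((n + 2) * norm y + n * (\<bar>\<theta>\<bar> * norm z)))
      + \<epsilon>\<^sup>2 * (norm v * ((2 * n\<^sup>2 + 8 * n + 4) * norm y + 2 * n\<^sup>2 * (\<bar>\<theta>\<bar> * norm z)))"
    by (simp add: algebra_simps power2_eq_square)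
  finally show ?thesis .
qed

section \<open>The residual to first order, for runs with bounded data\<close>

lemma SM_residual_first_order:
  fixes A :: "real^'n^'n"
  assumes inv: "invertible A" and Y0: "0 \<le> Y" and Z0: "0 \<le> Z" and T0: "0 \<le> T"
  shows "\<exists>K. \<forall>\<epsilon> y z \<alpha> \<beta> \<theta> x. SM_run cs \<epsilon> A u v b y z \<alpha> \<beta> \<theta> x \<longrightarrow>
     real CARD('n) * \<epsilon> \<le> 1/2 \<longrightarrow> norm y \<le> Y \<longrightarrow> norm z \<le> Z \<longrightarrow> \<bar>\<theta>\<bar> \<le> T \<longrightarrow>
     norm (residual A u v b x) \<le>
       \<epsilon> * (real CARD('n) + 2 + cs) * (norm2 A + norm u * norm v) * norm x
       + \<epsilon> * cs * norm b
       + \<epsilon> * (2 * real CARD('n) + 3 + 2 * cs) * (norm2 A + norm u * norm v) * norm y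
       + K * \<epsilon>\<^sup>2"
proof -
  define n where "n = real CARD('n)"
  define a where "a = norm2 A"
  define M where "M = a + norm u * norm v"
  \<comment> \<open>These constants depend on the a priori bounds but not on the run.
    \<open>W\<close> bounds the norm of \<theta> z, and \<open>P\<close> that of y - w, since
    rounding at most doubles \<theta> z. \<open>S1\<close> and \<open>S2\<close> bound the first-
    and second-order coefficients of the defect of \<theta>. \<open>K\<close> collects all products
    carrying a second factor \<epsilon>.\<close>
  define W where "W = T * Z"
  define P where "P = Y + 2 * W"
  define S1 where "S1 = norm v * ((n + 2) * Y + n * W)"
  define S2 where "S2 = norm v * ((2 * n\<^sup>2 + 8 * n + 4) * Y + 2 * n\<^sup>2 * W)"
  define K where "K = cs * norm u * (S1 + S2 + norm v * (W + P)) + cs * a * (P + W)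
    + norm u * norm v * n * (P + W) + norm u * S2 + M * (2 * P + W)"
  show ?thesis unfolding n_def[symmetric] a_def[symmetric] unfolding M_def[symmetric]
  proof (intro exI[of _ K] allI impI)
    fix \<epsilon> y z \<alpha> \<beta> \<theta> x
    assume run: "SM_run cs \<epsilon> A u v b y z \<alpha> \<beta> \<theta> x" and small: "n * \<epsilon> \<le> 1/2"
      and yY: "norm y \<le> Y" and zZ: "norm z \<le> Z" and tT: "\<bar>\<theta>\<bar> \<le> T"
    have e0: "0 < \<epsilon>" using run by (simp add: SM_run_def)
    have e1: "\<epsilon> \<le> 1/2" by (rule card_mult_half_imp[OF e0 small[unfolded n_def]])
    have n0: "0 \<le> n" by (simp add: n_def)
    have a0: "0 \<le> a" by (simp add: a_def)
    have M0: "0 \<le> M" using a0 by (simp add: M_def)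
    have cs0: "0 \<le> cs" by (rule SM_run_cs_nonneg[OF inv run])
    have W0: "0 \<le> W" using T0 Z0 by (simp add: W_def)
    define q where "q = \<bar>\<theta>\<bar> * norm z"
    have q0: "0 \<le> q" by (simp add: q_def)
    have qW: "q \<le> W" unfolding q_def W_def using tT zZ T0 by (intro mult_mono) auto

    obtain E1 e where E1: "(A + E1) *v y = b + e" "norm2 E1 \<le> cs * \<epsilon> * a" "norm e \<le> cs * \<epsilon> * norm b"
      using run unfolding SM_run_def backward_stable_solve_def a_def by blast
    obtain E2 f where E2: "(A + E2) *v z = u + f" "norm2 E2 \<le> cs * \<epsilon> * a" "norm f \<le> cs * \<epsilon> * norm u"
      using run unfolding SM_run_def backward_stable_solve_def a_def by blast
    obtain w where w: "\<And>i. fl \<epsilon> (z $ i * \<theta>) (w $ i)" and x: "\<And>i. fl \<epsilon> (y $ i - w $ i) (x $ i)"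
      using run unfolding SM_run_def by blast
    define p where "p = y - w"
    define \<sigma> where "\<sigma> = \<theta> * (1 + v \<bullet> z) - v \<bullet> y"

    have "norm (w - \<theta> *\<^sub>R z) \<le> \<epsilon> * norm (\<theta> *\<^sub>R z)"
      using e0 fl_error[OF w] by (intro norm_componentwise_scale_le) (auto simp: mult_ac)
    hence we: "norm (w - \<theta> *\<^sub>R z) \<le> \<epsilon> * q" by (simp add: q_def)
    have xe: "norm (x - p) \<le> \<epsilon> * norm p"
      using e0 fl_error[OF x] by (intro norm_componentwise_scale_le) (auto simp: p_def)
    have eq1: "\<epsilon> * q \<le> q" using mult_right_mono[of \<epsilon> 1 q] e1 q0 by simp
    have nw: "norm w \<le> q + \<epsilon> * q"
      using we norm_triangle_ineq[of "w - \<theta> *\<^sub>R z" "\<theta> *\<^sub>R z"] by (simp add: q_def)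
    have pP: "norm p \<le> P"
      using nw eq1 qW yY norm_triangle_ineq4[of y w] by (simp add: p_def P_def)
    have P0: "0 \<le> P" using pP norm_ge_zero[of p] by linarith
    have eP: "\<epsilon> * norm p \<le> \<epsilon> * P" using pP e0 by (intro mult_left_mono) auto
    have eW: "\<epsilon> * q \<le> \<epsilon> * W" using qW e0 by (intro mult_left_mono) auto
    have px: "norm p \<le> norm x + \<epsilon> * P"
      using xe eP norm_triangle_sub[of p x] by (simp add: norm_minus_commute)
    \<comment> \<open>The vector \<theta> z is close to w = y - p, and p is close to x. This trades
      z, absent from the claim, for x and y.\<close>
    have qxy: "q \<le> norm y + norm x + \<epsilon> * (P + W)"
    proof -
      have "q = norm (\<theta> *\<^sub>R z)" by (simp add: q_def)
      also have "\<dots> \<le> norm w + norm (w - \<theta> *\<^sub>R z)"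
        using norm_triangle_ineq4[of w "w - \<theta> *\<^sub>R z"] by simp
      also have "norm w \<le> norm y + norm p"
        using norm_triangle_ineq4[of y p] by (simp add: p_def)
      finally show ?thesis using px we eW by (simp add: algebra_simps)
    qed

    have sig: "\<bar>\<sigma>\<bar> \<le> \<epsilon> * (norm v * ((n + 2) * norm y + n * q)) + \<epsilon>\<^sup>2 * S2"
    proof -
      have "norm v * ((2 * n\<^sup>2 + 8 * n + 4) * norm y + 2 * n\<^sup>2 * q) \<le> S2"
        unfolding S2_def using yY qW n0 by (intro mult_left_mono add_mono) auto
      hence "\<epsilon>\<^sup>2 * (norm v * ((2 * n\<^sup>2 + 8 * n + 4) * norm y + 2 * n\<^sup>2 * q)) \<le> \<epsilon>\<^sup>2 * S2"
        by (intro mult_left_mono) auto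
      thus ?thesis
        using SM_theta_defect[OF run small[unfolded n_def], folded n_def]
        unfolding \<sigma>_def q_def by linarith
    qed
    have S20: "0 \<le> S2" unfolding S2_def using Y0 W0 n0 by simp
    \<comment> \<open>This crude form is enough for \<open>th\<close>, which is later multiplied by
      another \<epsilon>.\<close>
    have sig': "\<bar>\<sigma>\<bar> \<le> \<epsilon> * (S1 + S2)"
    proof -
      have "norm v * ((n + 2) * norm y + n * q) \<le> S1"
        unfolding S1_def using yY qW n0 by (intro mult_left_mono add_mono) auto
      hence "\<epsilon> * (norm v * ((n + 2) * norm y + n * q)) \<le> \<epsilon> * S1"
        using e0 by (intro mult_left_mono) auto
      moreover have "\<epsilon> * \<epsilon> * S2 \<le> \<epsilon> * 1 * S2"
        using S20 e0 e1 by (intro mult_right_mono mult_left_mono) auto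
      ultimately show ?thesis using sig by (simp add: power2_eq_square algebra_simps)
    qed

    \<comment> \<open>In exact arithmetic \<open>\<theta> = v \<bullet> x\<close>. This is what bounds the contribution \<open>\<theta> \<delta>u\<close> by
      \<open>\<parallel>u\<parallel> \<parallel>v\<parallel> \<parallel>x\<parallel>\<close>; going through \<open>\<parallel>u\<parallel> \<le> \<parallel>A\<parallel> \<parallel>z\<parallel>\<close> instead would cost a larger constant.\<close>
    have th: "\<bar>\<theta>\<bar> \<le> norm v * norm x + \<epsilon> * (S1 + S2 + norm v * (W + P))"
    proof -
      have eq: "\<theta> = v \<bullet> x + \<sigma> + v \<bullet> (w - \<theta> *\<^sub>R z) - v \<bullet> (x - p)"
        by (simp add: \<sigma>_def p_def inner_diff_right algebra_simps)
      have 1: "\<bar>v \<bullet> x\<bar> \<le> norm v * norm x" by (rule Cauchy_Schwarz_ineq2)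
      have 2: "\<bar>v \<bullet> (w - \<theta> *\<^sub>R z)\<bar> \<le> norm v * (\<epsilon> * W)"
        using Cauchy_Schwarz_ineq2[of v "w - \<theta> *\<^sub>R z"] we eW
        by (meson mult_left_mono norm_ge_zero order_trans)
      have 3: "\<bar>v \<bullet> (x - p)\<bar> \<le> norm v * (\<epsilon> * P)"
        using Cauchy_Schwarz_ineq2[of v "x - p"] xe eP
        by (meson mult_left_mono norm_ge_zero order_trans)
      have "\<bar>\<theta>\<bar> \<le> norm v * norm x + \<epsilon> * (S1 + S2) + norm v * (\<epsilon> * W) + norm v * (\<epsilon> * P)"
        using eq 1 2 3 sig' by linarith
      thus ?thesis by (simp add: algebra_simps)
    qed

    have Ay: "A *v y = b + e - E1 *v y" and Az: "A *v z = u + f - E2 *v z"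
      using E1(1) E2(1) by (simp_all add: matrix_vector_mult_add_rdistrib eq_diff_eq)
    define B where "B = A + outer u v"
    \<comment> \<open>Here x is compared with y - \<theta> z, formed without rounding from the
      computed y, z and \<theta>. The last two terms carry the rounding of the product and of the
      subtraction.\<close>
    have "residual A u v b x
      = b - B *v (y - \<theta> *\<^sub>R z) + B *v (w - \<theta> *\<^sub>R z) - B *v (x - p)"
      by (simp add: residual_def B_def[symmetric] p_def matrix_vector_mult_diff_distrib algebra_simps)
    also have "B *v (y - \<theta> *\<^sub>R z) = A *v y - \<theta> *\<^sub>R (A *v z) + (v \<bullet> y - \<theta> * (v \<bullet> z)) *\<^sub>R u"
      by (simp add: B_def matrix_vector_mult_add_rdistrib outer_vector inner_diff_right
          matrix_vector_mult_diff_distrib matrix_vector_mult_scaleR algebra_simps)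
    \<comment> \<open>Inserting \<open>Az\<close> brings in a multiple \<theta> of u, and all
      multiples of u combine to exactly the defect \<sigma>.\<close>
    also have "b - \<dots> = - e + E1 *v y + \<theta> *\<^sub>R f - \<theta> *\<^sub>R (E2 *v z) + \<sigma> *\<^sub>R u"
      unfolding Ay Az \<sigma>_def by (simp add: algebra_simps)
    finally have "residual A u v b x = - e + E1 *v y + \<theta> *\<^sub>R f - \<theta> *\<^sub>R (E2 *v z) + \<sigma> *\<^sub>R u
        + B *v (w - \<theta> *\<^sub>R z) - B *v (x - p)" .
    hence "norm (residual A u v b x) \<le> norm e + norm (E1 *v y) + norm (\<theta> *\<^sub>R f)
        + norm (\<theta> *\<^sub>R (E2 *v z)) + norm (\<sigma> *\<^sub>R u) + norm (B *v (w - \<theta> *\<^sub>R z)) + norm (B *v (x - p))"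
      by (smt (verit) norm_minus_cancel norm_triangle_ineq norm_triangle_ineq4)
    also have "\<dots> \<le> cs * \<epsilon> * norm b + cs * \<epsilon> * a * norm y + \<bar>\<theta>\<bar> * (cs * \<epsilon> * norm u)
        + cs * \<epsilon> * a * q + \<bar>\<sigma>\<bar> * norm u + M * (\<epsilon> * q) + M * (\<epsilon> * norm p)"
    proof (intro add_mono)
      show "norm (E1 *v y) \<le> cs * \<epsilon> * a * norm y"
        by (rule order_trans[OF norm_matrix_vector_le mult_right_mono[OF E1(2)]]) simp
      show "norm (\<theta> *\<^sub>R f) \<le> \<bar>\<theta>\<bar> * (cs * \<epsilon> * norm u)" using E2(3) by (simp add: mult_left_mono)
      have "norm (E2 *v z) \<le> cs * \<epsilon> * a * norm z"
        by (rule order_trans[OF norm_matrix_vector_le mult_right_mono[OF E2(2)]]) simp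
      hence "\<bar>\<theta>\<bar> * norm (E2 *v z) \<le> \<bar>\<theta>\<bar> * (cs * \<epsilon> * a * norm z)" by (rule mult_left_mono) simp
      thus "norm (\<theta> *\<^sub>R (E2 *v z)) \<le> cs * \<epsilon> * a * q" by (simp add: q_def mult_ac)
      have B: "norm (B *v s) \<le> M * norm s" for s
        unfolding B_def M_def a_def by (rule norm_update_le)
      show "norm (B *v (w - \<theta> *\<^sub>R z)) \<le> M * (\<epsilon> * q)"
        by (rule order_trans[OF B mult_left_mono[OF we M0]])
      show "norm (B *v (x - p)) \<le> M * (\<epsilon> * norm p)"
        by (rule order_trans[OF B mult_left_mono[OF xe M0]])
    qed (use E1 in auto)
    also have "\<dots> \<le> cs * \<epsilon> * norm b + cs * \<epsilon> * a * norm y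
        + (norm v * norm x + \<epsilon> * (S1 + S2 + norm v * (W + P))) * (cs * \<epsilon> * norm u)
        + cs * \<epsilon> * a * (norm y + norm x + \<epsilon> * (P + W))
        + (\<epsilon> * (norm v * ((n + 2) * norm y + n * (norm y + norm x + \<epsilon> * (P + W)))) + \<epsilon>\<^sup>2 * S2) * norm u
        + M * (\<epsilon> * (norm y + norm x + \<epsilon> * (P + W))) + M * (\<epsilon> * (norm x + \<epsilon> * P))"
    proof -
      have "\<epsilon> * (norm v * ((n + 2) * norm y + n * q))
          \<le> \<epsilon> * (norm v * ((n + 2) * norm y + n * (norm y + norm x + \<epsilon> * (P + W))))"
        using qxy e0 n0 by (intro mult_left_mono add_left_mono) auto
      hence "\<bar>\<sigma>\<bar> \<le> \<epsilon> * (norm v * ((n + 2) * norm y + n * (norm y + norm x + \<epsilon> * (P + W)))) + \<epsilon>\<^sup>2 * S2"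
        using sig by linarith
      thus ?thesis using th qxy px e0 cs0 a0 M0
        by (intro add_mono mult_right_mono mult_left_mono order_refl) auto
    qed
    \<comment> \<open>For y, the two solves contribute \<open>2 * cs * a\<close>, the defect (n + 2)
      + n, and the rounded product M. For x, the perturbations of the solve for z give
      \<open>cs * M\<close>, the defect n, and the two roundings \<open>2 * M\<close>.\<close>
    also have "\<dots> = \<epsilon> * cs * norm b + \<epsilon> * ((2 * cs * a + (2 * n + 2) * (norm u * norm v) + M) * norm y)
        + \<epsilon> * ((cs * M + n * (norm u * norm v) + 2 * M) * norm x) + K * \<epsilon>\<^sup>2"
      unfolding K_def by (simp add: M_def algebra_simps power2_eq_square)
    \<comment> \<open>Enlarging both \<open>a\<close> and \<open>norm u * norm v\<close> to
      \<open>M\<close> turns these coefficients into the constants of the claim.\<close>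
    also have "\<dots> \<le> \<epsilon> * cs * norm b + \<epsilon> * ((2 * n + 3 + 2 * cs) * M * norm y)
        + \<epsilon> * ((n + 2 + cs) * M * norm x) + K * \<epsilon>\<^sup>2"
    proof -
      have "2 * cs * a + (2 * n + 2) * (norm u * norm v) + M \<le> (2 * n + 3 + 2 * cs) * M"
        using cs0 a0 n0 by (simp add: M_def algebra_simps)
      moreover have "cs * M + n * (norm u * norm v) + 2 * M \<le> (n + 2 + cs) * M"
        using a0 n0 by (simp add: M_def algebra_simps)
      ultimately show ?thesis using e0
        by (intro add_mono mult_left_mono mult_right_mono order_refl) auto
    qed
    finally show "norm (residual A u v b x) \<le> \<epsilon> * (n + 2 + cs) * M * norm x + \<epsilon> * cs * norm b
        + \<epsilon> * (2 * n + 3 + 2 * cs) * M * norm y + K * \<epsilon>\<^sup>2"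
      by (simp add: algebra_simps)
  qed
qed

section \<open>Bounds on the computed quantities, uniform in the run\<close>

lemma sherman_morrison_denominator_nonzero:
  fixes A :: "real^'n^'n"
  assumes "invertible A" "invertible (A + outer u v)"
  shows "1 + v \<bullet> (matrix_inv A *v u) \<noteq> 0"
proof
  assume z: "1 + v \<bullet> (matrix_inv A *v u) = 0"
  \<comment> \<open>If the factor vanished, injectivity of the updated matrix would give
    \<open>matrix_inv A *v u = 0\<close>, and then the factor would equal 1.\<close>
  have "(A + outer u v) *v (matrix_inv A *v u) = (1 + v \<bullet> (matrix_inv A *v u)) *\<^sub>R u"
    by (simp add: matrix_vector_mult_add_rdistrib outer_vector matrix_inv_vector[OF assms(1)]
        algebra_simps)
  hence "matrix_inv A *v u = 0"
    using z matrix_inv_vector(1)[OF assms(2), of "matrix_inv A *v u"] by simp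
  thus False using z by simp
qed

lemma eventually_at_right_0_mult_less:
  fixes c d :: real
  assumes "0 < d"
  shows "\<forall>\<^sub>F \<epsilon> in at_right 0. c * \<epsilon> < d"
proof -
  have "((\<lambda>\<epsilon>::real. c * \<epsilon>) \<longlongrightarrow> c * 0) (at_right 0)" by (intro tendsto_intros)
  thus ?thesis using assms by (intro order_tendstoD(2)) auto
qed

text \<open>This supplies the bounds that \<open>SM_residual_first_order\<close> presupposes. The
  computed z approaches its exact value at rate \<epsilon>, uniformly over all runs, so the computed
  \<beta> stays away from 0 and \<theta> cannot blow up.\<close>

lemma SM_run_eventually_bounded:
  fixes A :: "real^'n^'n"
  assumes inv: "invertible A" and inv': "invertible (A + outer u v)"
  defines "m \<equiv> norm2 (matrix_inv A)"
  shows "\<forall>\<^sub>F \<epsilon> in at_right 0. \<forall>y z \<alpha> \<beta> \<theta> x. SM_run cs \<epsilon> A u v b y z \<alpha> \<beta> \<theta> x \<longrightarrow>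
     norm y \<le> 2 * m * norm b \<and> norm z \<le> 2 * m * norm u \<and>
     \<bar>\<theta>\<bar> \<le> 16 * norm v * (2 * m * norm b) / \<bar>1 + v \<bullet> (matrix_inv A *v u)\<bar>"
proof -
  define n where "n = real CARD('n)"
  define Z where "Z = 2 * m * norm u"
  define Y where "Y = 2 * m * norm b"
  define \<beta>0 where "\<beta>0 = 1 + v \<bullet> (matrix_inv A *v u)"
  \<comment> \<open>The two summands are the effect of the solve error in z and the rounding of the
    inner product on the computed \<open>1 + t\<close>.\<close>
  define C where "C = norm v * (m * (cs * norm u + cs * norm2 A * Z)) + 2 * n * (norm v * Z)"
  have b0: "0 < \<bar>\<beta>0\<bar>"
    using sherman_morrison_denominator_nonzero[OF inv inv'] by (simp add: \<beta>0_def)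
  have m0: "0 \<le> m" by (simp add: m_def)
  have "\<forall>\<^sub>F \<epsilon> in at_right 0. n * \<epsilon> < 1/2 \<and> (2 * cs * kappa A) * \<epsilon> < 1/2 \<and> C * \<epsilon> < \<bar>\<beta>0\<bar> / 2"
    using b0 by (intro eventually_conj eventually_at_right_0_mult_less) auto
  thus ?thesis unfolding Z_def[symmetric] Y_def[symmetric] \<beta>0_def[symmetric]
  proof (eventually_elim, intro allI impI)
    fix \<epsilon> y z \<alpha> \<beta> \<theta> x
    assume small: "n * \<epsilon> < 1/2 \<and> (2 * cs * kappa A) * \<epsilon> < 1/2 \<and> C * \<epsilon> < \<bar>\<beta>0\<bar> / 2"
      and run: "SM_run cs \<epsilon> A u v b y z \<alpha> \<beta> \<theta> x"
    have e0: "0 < \<epsilon>" using run by (simp add: SM_run_def)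
    have ne: "real CARD('n) * \<epsilon> \<le> 1/2" using small by (simp add: n_def)
    have e1: "\<epsilon> \<le> 1/2" by (rule card_mult_half_imp[OF e0 ne])
    note g = gam_bounds[OF less_imp_le[OF e0] ne, folded n_def]
    have ck: "2 * cs * \<epsilon> * kappa A < 1/2" using small by (simp add: mult_ac)
    \<comment> \<open>The denominator in \<open>solve_bound\<close> exceeds 1/2. Its constant
      \<open>2 * cs\<close> is used because both solves need a bound, and \<open>c1\<close> is only
      tied to y.\<close>
    have solve: "norm s \<le> 2 * m * norm h" if "backward_stable_solve cs \<epsilon> A h s" for h s
    proof -
      have "norm s \<le> m * norm h / (1 - 2 * cs * \<epsilon> * kappa A)"
        unfolding m_def using ck by (intro solve_bound[OF inv e0 that]) simp
      also have "\<dots> \<le> m * norm h / (1/2)" using ck m0 by (intro divide_left_mono) auto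
      finally show ?thesis by simp
    qed
    have yY: "norm y \<le> Y" and zZ: "norm z \<le> Z"
      using run solve unfolding SM_run_def Y_def Z_def by auto
    obtain E f where E: "(A + E) *v z = u + f" "norm2 E \<le> cs * \<epsilon> * norm2 A" "norm f \<le> cs * \<epsilon> * norm u"
      using run unfolding SM_run_def backward_stable_solve_def by blast
    obtain t where ts: "fl_inner \<epsilon> v y \<alpha>" "fl_inner \<epsilon> v z t" "fl \<epsilon> (1 + t) \<beta>"
        "\<beta> \<noteq> 0" "fl \<epsilon> (\<alpha> / \<beta>) \<theta>"
      using run unfolding SM_run_def by blast
    have "A *v z = u + (f - E *v z)"
      using E(1) by (simp add: matrix_vector_mult_add_rdistrib algebra_simps)
    hence dz: "z - matrix_inv A *v u = matrix_inv A *v (f - E *v z)"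
      using matrix_inv_vector(1)[OF inv, of z]
      by (metis add_diff_cancel_left' matrix_vector_right_distrib)
    have "norm (E *v z) \<le> (cs * \<epsilon> * norm2 A) * Z"
      using norm_matrix_vector_le[of E z] mult_mono'[OF E(2) zZ] by simp
    hence "norm (f - E *v z) \<le> \<epsilon> * (cs * norm u + cs * norm2 A * Z)"
      using E(3) norm_triangle_ineq4[of f "E *v z"] by (simp add: algebra_simps)
    hence "norm (z - matrix_inv A *v u) \<le> m * (\<epsilon> * (cs * norm u + cs * norm2 A * Z))"
      unfolding dz m_def by (intro order_trans[OF norm_matrix_vector_le] mult_left_mono) auto
    hence 1: "\<bar>v \<bullet> (z - matrix_inv A *v u)\<bar>
        \<le> norm v * (m * (\<epsilon> * (cs * norm u + cs * norm2 A * Z)))"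
      by (intro order_trans[OF Cauchy_Schwarz_ineq2] mult_left_mono) auto
    have "\<bar>t - v \<bullet> z\<bar> \<le> gam CARD('n) \<epsilon> * (norm v * norm z)"
      by (rule fl_inner_error[OF ts(2) g(1)])
    also have "\<dots> \<le> 2 * n * \<epsilon> * (norm v * Z)"
      using g zZ e0 by (intro mult_mono mult_left_mono) (auto simp: n_def)
    finally have "\<bar>(1 + t) - \<beta>0\<bar> \<le> C * \<epsilon>"
      using 1 unfolding C_def \<beta>0_def by (simp add: inner_diff_right algebra_simps)
    hence t: "\<bar>\<beta>0\<bar> / 2 \<le> \<bar>1 + t\<bar>" using small by linarith
    have "\<bar>\<beta> - (1 + t)\<bar> \<le> 1/2 * \<bar>1 + t\<bar>"
      using fl_error[OF ts(3)] mult_right_mono[OF e1, of "\<bar>1 + t\<bar>"] by linarith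
    \<comment> \<open>At most half of the exact value is lost through \<open>C * \<epsilon>\<close>,
      and at most half of the rest through rounding the sum.\<close>
    hence beta: "\<bar>\<beta>0\<bar> / 4 \<le> \<bar>\<beta>\<bar>" using t by (simp add: abs_if split: if_splits)
    have g1: "gam CARD('n) \<epsilon> \<le> 1" using g(2) ne by (simp add: n_def)
    have "\<bar>\<alpha> - v \<bullet> y\<bar> \<le> 1 * (norm v * norm y)"
      using fl_inner_error[OF ts(1) g(1)] mult_right_mono[OF g1, of "norm v * norm y"] by simp
    hence "\<bar>\<alpha>\<bar> \<le> 2 * (norm v * norm y)" using Cauchy_Schwarz_ineq2[of v y] by linarith
    also have "\<dots> \<le> 2 * (norm v * Y)" using yY by (simp add: mult_left_mono)
    finally have alpha: "\<bar>\<alpha>\<bar> \<le> 2 * (norm v * Y)" .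
    have "\<bar>\<theta> - \<alpha> / \<beta>\<bar> \<le> 1 * \<bar>\<alpha> / \<beta>\<bar>"
      using fl_error[OF ts(5)] mult_right_mono[of \<epsilon> 1 "\<bar>\<alpha> / \<beta>\<bar>"] e1 by linarith
    hence "\<bar>\<theta>\<bar> \<le> 2 * (\<bar>\<alpha>\<bar> / \<bar>\<beta>\<bar>)" by (simp add: abs_divide[symmetric] del: abs_divide)
    also have "\<bar>\<alpha>\<bar> / \<bar>\<beta>\<bar> \<le> 2 * (norm v * Y) / (\<bar>\<beta>0\<bar> / 4)"
      using alpha beta b0 by (intro frac_le) auto
    \<comment> \<open>The factor is 2 for rounding the quotient, 2 for the error in \<alpha>, and 4
      for the lower bound on \<beta>.\<close>
    finally have "\<bar>\<theta>\<bar> \<le> 16 * norm v * Y / \<bar>\<beta>0\<bar>" by simp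
    thus "norm y \<le> Y \<and> norm z \<le> Z \<and> \<bar>\<theta>\<bar> \<le> 16 * norm v * Y / \<bar>\<beta>0\<bar>"
      using yY zZ by simp
  qed
qed

section \<open>Assembling the residual and backward error bounds\<close>

lemma SM_run_zero:
  assumes "SM_run cs \<epsilon> A u v b 0 z \<alpha> \<beta> 0 x"
  shows "x = 0"
proof -
  obtain w :: "real^'a" where w: "\<And>i. fl \<epsilon> (z $ i * 0) (w $ i)"
      and x: "\<And>i. fl \<epsilon> ((0 :: real^'a) $ i - w $ i) (x $ i)"
    using assms unfolding SM_run_def by blast
  have "w $ i = 0" for i using fl_error[OF w, of i] by simp
  hence "x $ i = 0" for i using fl_error[OF x, of i] by simp
  thus ?thesis by (simp add: vec_eq_iff)
qed

text \<open>Choosing \<open>g\<close> and \<open>h\<close> before \<epsilon> and the run makes the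
  second-order terms uniform over all admissible roundings. The third conjunct makes the order of
  the second term explicit: a constant, depending on the ratio of \<open>norm u * norm v\<close> to
  \<open>norm2 A\<close>, times \<open>\<epsilon> * kappa A\<close>.\<close>

theorem corollary2p3:
  fixes A :: "real^'n^'n" and u v b :: "real^'n" and cs c1 :: real
  assumes "invertible A" and "invertible (A + outer u v)"
  shows "\<exists>g h :: real \<Rightarrow> real.
    g \<in> O[at_right 0](\<lambda>\<epsilon>. \<epsilon>\<^sup>2) \<and> h \<in> O[at_right 0](\<lambda>\<epsilon>. \<epsilon>\<^sup>2) \<and>
    (\<forall>\<^sub>F \<epsilon> in at_right 0. \<forall>y z \<alpha> \<beta> \<theta> x.
       SM_run cs \<epsilon> A u v b y z \<alpha> \<beta> \<theta> x \<longrightarrow>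
       c1 * \<epsilon> * kappa A < 1 \<longrightarrow>
       norm y \<le> norm2 (matrix_inv A) * norm b / (1 - c1 * \<epsilon> * kappa A) \<longrightarrow>
       norm (residual A u v b x)
         \<le> \<epsilon> * (real CARD('n) + 2 + cs) * (norm2 A + norm u * norm v) * norm x
           + \<epsilon> * cs * norm b
           + \<epsilon> * ((2 * real CARD('n) + 3 + 2 * cs) / (1 - c1 * \<epsilon> * kappa A))
               * (norm2 A + norm u * norm v) * norm2 (matrix_inv A) * norm b
           + g \<epsilon> \<and>
       backward_error A u v b x
         \<le> \<epsilon> * (real CARD('n) + 2 + cs)
               * (((norm2 A + norm u * norm v) * norm x + norm b)
                  / (norm2 (A + outer u v) * norm x + norm b))
           + \<epsilon> * ((2 * real CARD('n) + 3 + 2 * cs) / (1 - c1 * \<epsilon> * kappa A))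
               * ((norm2 A + norm u * norm v) * norm2 (matrix_inv A) * norm b
                  / (norm2 (A + outer u v) * norm x + norm b))
           + h \<epsilon> \<and>
       \<epsilon> * ((2 * real CARD('n) + 3 + 2 * cs) / (1 - c1 * \<epsilon> * kappa A))
           * ((norm2 A + norm u * norm v) * norm2 (matrix_inv A) * norm b
              / (norm2 (A + outer u v) * norm x + norm b))
         \<le> 2 * (2 * real CARD('n) + 3 + 2 * cs) * (1 + norm u * norm v / norm2 A)
             * (\<epsilon> * kappa A))"
proof -
  define n where "n = real CARD('n)"
  define M where "M = norm2 A + norm u * norm v"
  define m where "m = norm2 (matrix_inv A)"
  define Y where "Y = 2 * m * norm b"
  define Z where "Z = 2 * m * norm u"
  define T where "T = 16 * norm v * Y / \<bar>1 + v \<bullet> (matrix_inv A *v u)\<bar>"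
  have m0: "0 \<le> m" by (simp add: m_def)
  have M0: "0 \<le> M" by (simp add: M_def)
  have A0: "0 < norm2 A" by (rule norm2_pos[OF assms(1)])
  have YZT: "0 \<le> Y" "0 \<le> Z" "0 \<le> T" using m0 by (simp_all add: Y_def Z_def T_def)
  obtain K where K: "\<And>\<epsilon> y z \<alpha> \<beta> \<theta> x. SM_run cs \<epsilon> A u v b y z \<alpha> \<beta> \<theta> x \<Longrightarrow>
     n * \<epsilon> \<le> 1/2 \<Longrightarrow> norm y \<le> Y \<Longrightarrow> norm z \<le> Z \<Longrightarrow> \<bar>\<theta>\<bar> \<le> T \<Longrightarrow>
     norm (residual A u v b x) \<le> \<epsilon> * (n + 2 + cs) * M * norm x + \<epsilon> * cs * norm b
       + \<epsilon> * (2 * n + 3 + 2 * cs) * M * norm y + K * \<epsilon>\<^sup>2"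
    using SM_residual_first_order[OF assms(1) YZT, of cs u v b] unfolding n_def M_def by blast
  define g where "g = (\<lambda>\<epsilon>::real. \<bar>K\<bar> * \<epsilon>\<^sup>2)"
  \<comment> \<open>For \<open>b = 0\<close> the factor is \<open>\<bar>K\<bar> / 0 = 0\<close>; then \<open>x = 0\<close> and no remainder is needed.\<close>
  define h where "h = (\<lambda>\<epsilon>::real. \<bar>K\<bar> / norm b * \<epsilon>\<^sup>2)"
  have gO: "g \<in> O[at_right 0](\<lambda>\<epsilon>. \<epsilon>\<^sup>2)" "h \<in> O[at_right 0](\<lambda>\<epsilon>. \<epsilon>\<^sup>2)"
    unfolding g_def h_def by (simp_all del: times_divide_eq_left)
  \<comment> \<open>The second condition keeps the denominator \<open>k\<close> at least 1/2 and is
    the origin of the factor 2 in the third conjunct.\<close>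
  have ev: "\<forall>\<^sub>F \<epsilon> in at_right 0. n * \<epsilon> < 1/2 \<and> (c1 * kappa A) * \<epsilon> < 1/2"
    by (intro eventually_conj eventually_at_right_0_mult_less) auto
  have ev': "\<forall>\<^sub>F \<epsilon> in at_right 0. \<forall>y z \<alpha> \<beta> \<theta> x.
      SM_run cs \<epsilon> A u v b y z \<alpha> \<beta> \<theta> x \<longrightarrow> norm y \<le> Y \<and> norm z \<le> Z \<and> \<bar>\<theta>\<bar> \<le> T"
    unfolding T_def Y_def Z_def m_def by (rule SM_run_eventually_bounded[OF assms])
  show ?thesis
    unfolding n_def[symmetric] m_def[symmetric] M_def[symmetric]
  proof (rule exI[of _ g], rule exI[of _ h], intro conjI gO, use ev ev' in eventually_elim,
      intro allI impI)
    fix \<epsilon> y z \<alpha> \<beta> \<theta> x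
    assume small: "n * \<epsilon> < 1/2 \<and> (c1 * kappa A) * \<epsilon> < 1/2"
      and bnd: "\<forall>y z \<alpha> \<beta> \<theta> x. SM_run cs \<epsilon> A u v b y z \<alpha> \<beta> \<theta> x \<longrightarrow>
        norm y \<le> Y \<and> norm z \<le> Z \<and> \<bar>\<theta>\<bar> \<le> T"
      and run: "SM_run cs \<epsilon> A u v b y z \<alpha> \<beta> \<theta> x"
      and ybound: "norm y \<le> m * norm b / (1 - c1 * \<epsilon> * kappa A)"
    have yzt: "norm y \<le> Y" "norm z \<le> Z" "\<bar>\<theta>\<bar> \<le> T" using bnd run by blast+
    have e0: "0 < \<epsilon>" using run by (simp add: SM_run_def)
    have cs0: "0 \<le> cs" by (rule SM_run_cs_nonneg[OF assms(1) run])
    have n0: "0 \<le> n" by (simp add: n_def)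
    define k where "k = 1 - c1 * \<epsilon> * kappa A"
    define N where "N = 2 * n + 3 + 2 * cs"
    define den where "den = norm2 (A + outer u v) * norm x + norm b"
    have k: "1/2 \<le> k" using small by (simp add: k_def mult_ac)
    have N0: "0 \<le> N" using n0 cs0 by (simp add: N_def)
    have den0: "0 \<le> den" by (simp add: den_def)
    have denb: "norm b \<le> den" by (simp add: den_def)
    \<comment> \<open>For b = 0 the bounds \<open>Y\<close> and \<open>T\<close> vanish, hence so do
      y and \<theta>. Rounding is purely relative, so x is exactly 0.\<close>
    have x0: "x = 0" if "b = 0"
    proof -
      have "y = 0" "\<theta> = 0" using yzt that by (simp_all add: T_def Y_def)
      thus ?thesis using SM_run_zero run by blast
    qed
    have "\<epsilon> * N * M * norm y \<le> \<epsilon> * N * M * (m * norm b / k)"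
      using ybound e0 N0 M0 by (intro mult_left_mono) (auto simp: k_def)
    hence r: "norm (residual A u v b x) \<le> \<epsilon> * (n + 2 + cs) * M * norm x + \<epsilon> * cs * norm b
       + \<epsilon> * (N / k) * M * m * norm b + K * \<epsilon>\<^sup>2"
      using K[OF run _ yzt] small by (simp add: N_def mult_ac)
    have "K * \<epsilon>\<^sup>2 \<le> g \<epsilon>" unfolding g_def by (intro mult_right_mono) auto
    hence r1: "norm (residual A u v b x) \<le> \<epsilon> * (n + 2 + cs) * M * norm x + \<epsilon> * cs * norm b
       + \<epsilon> * (N / k) * M * m * norm b + g \<epsilon>"
      using r by linarith
    have r2: "backward_error A u v b x \<le> \<epsilon> * (n + 2 + cs) * ((M * norm x + norm b) / den)
       + \<epsilon> * (N / k) * (M * m * norm b / den) + h \<epsilon>"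
    proof (cases "b = 0")
      case True
      thus ?thesis using x0 by (simp add: backward_error_def residual_def h_def)
    next
      case False
      have dpos: "0 < den" using False denb by (smt (verit) zero_less_norm_iff)
      \<comment> \<open>Raising \<open>cs\<close> to \<open>n + 2 + cs\<close> merges the term in b
        with the term in x.\<close>
      have "\<epsilon> * cs * norm b \<le> \<epsilon> * (n + 2 + cs) * norm b"
        using e0 n0 by (intro mult_right_mono mult_left_mono) auto
      hence "norm (residual A u v b x) \<le> \<epsilon> * (n + 2 + cs) * (M * norm x + norm b)
          + \<epsilon> * (N / k) * (M * m * norm b) + g \<epsilon>"
        using r1 by (simp add: algebra_simps)
      hence "backward_error A u v b x \<le> (\<epsilon> * (n + 2 + cs) * (M * norm x + norm b)
          + \<epsilon> * (N / k) * (M * m * norm b) + g \<epsilon>) / den"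
        unfolding backward_error_def den_def[symmetric] using dpos by (intro divide_right_mono) auto
      \<comment> \<open>The denominator is at least \<open>norm b\<close>, which does not depend on
        the run.\<close>
      moreover have "g \<epsilon> / den \<le> h \<epsilon>"
      proof -
        have "g \<epsilon> / den \<le> g \<epsilon> / norm b"
          using False denb dpos by (intro divide_left_mono) (auto simp: g_def)
        thus ?thesis by (simp add: g_def h_def)
      qed
      ultimately show ?thesis by (simp add: add_divide_distrib algebra_simps)
    qed
    have r3: "\<epsilon> * (N / k) * (M * m * norm b / den)
        \<le> 2 * N * (1 + norm u * norm v / norm2 A) * (\<epsilon> * kappa A)"
    proof -
      \<comment> \<open>Bounding the quotient of \<open>norm b\<close> and \<open>den\<close> by 1
        leaves \<open>M * m\<close>, which is \<open>kappa A\<close> up to the relative size of the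
        update.\<close>
      have "N / k \<le> N / (1/2)" using k N0 by (intro divide_left_mono) auto
      moreover have "norm b / den \<le> 1" using denb den0 by (auto simp: divide_le_eq_1)
      hence "M * m * (norm b / den) \<le> M * m * 1" using M0 m0 by (intro mult_left_mono) auto
      ultimately have "\<epsilon> * (N / k) * (M * m * (norm b / den)) \<le> \<epsilon> * (2 * N) * (M * m)"
        using e0 N0 M0 m0 k den0 by (intro mult_mono[of "\<epsilon> * (N / k)"] mult_left_mono) auto
      moreover have "M * m = (1 + norm u * norm v / norm2 A) * kappa A"
        using A0 by (simp add: M_def m_def kappa_def field_simps)
      ultimately show ?thesis by (simp add: mult_ac)
    qed
    show "norm (residual A u v b x) \<le> \<epsilon> * (n + 2 + cs) * M * norm x + \<epsilon> * cs * norm b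
          + \<epsilon> * ((2 * n + 3 + 2 * cs) / (1 - c1 * \<epsilon> * kappa A)) * M * m * norm b + g \<epsilon> \<and>
        backward_error A u v b x \<le> \<epsilon> * (n + 2 + cs)
            * ((M * norm x + norm b) / (norm2 (A + outer u v) * norm x + norm b))
          + \<epsilon> * ((2 * n + 3 + 2 * cs) / (1 - c1 * \<epsilon> * kappa A))
            * (M * m * norm b / (norm2 (A + outer u v) * norm x + norm b)) + h \<epsilon> \<and>
        \<epsilon> * ((2 * n + 3 + 2 * cs) / (1 - c1 * \<epsilon> * kappa A))
            * (M * m * norm b / (norm2 (A + outer u v) * norm x + norm b))
          \<le> 2 * (2 * n + 3 + 2 * cs) * (1 + norm u * norm v / norm2 A) * (\<epsilon> * kappa A)"
      using r1 r2 r3 unfolding N_def k_def den_def by blast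
  qed
qed

end
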